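(* Let $X$ be a real Asplund Banach space and let $x\in S_X$ be an $\omega$-strongly extreme point. Suppose that $\{x_n \mid n\in\mathbb{N}\}\subset B_X$ is a set such that $x\in\overline{\mathrm{conv}}(\{x_n\mid n\in\mathbb{N}\})$. Then there is a sequence $(x_{n_k})_{k}\subset\{x_n\mid n\in\mathbb{N}\}$ such that $x_{n_k}\to x$ in the weak topology of $X$ as $k\to\infty$.
   Context: For a real Banach space $X$, $B_X$ is the closed unit ball and $S_X$ the unit sphere; $\overline{\mathrm{conv}}$ denotes the norm-closed convex hull. $X$ is called an Asplund space if for every separable subspace $Y\subset X$ the dual $Y^*$ is separable. A point $x\in S_X$ is $\omega$-strongly extreme if for all sequences $(z_n),(y_n)\subset B_X$ such that $\frac{z_n+y_n}{2}\to x$ in norm it holds that $z_n-y_n\to 0$ in the weak topology of $X$. The conclusion asserts the existence of a sequence whose terms belong to the set $\{x_n\mid n\in\mathbb N\}$; the indices $n_k$ are not required to be increasing or distinct. *)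

theory Defs
  imports "HOL-Analysis.Analysis"
begin

definition weak_topology :: "'a::real_normed_vector topology" where
  "weak_topology = topology_generated_by
     {f -` U | (f :: 'a \<Rightarrow> real) U. bounded_linear f \<and> open U}"

lemma topspace_weak_topology [simp]: "topspace weak_topology = UNIV"
proof -
  have "UNIV \<in> {f -` U | (f :: 'a \<Rightarrow> real) U. bounded_linear f \<and> open U}"
    using bounded_linear_zero open_UNIV by blast
  then show ?thesis
    unfolding weak_topology_def topology_generated_by_topspace by blast
qed

lemma limitin_weak_topology:
  fixes l :: "'a::real_normed_vector"
  shows "limitin weak_topology x l F \<longleftrightarrow>
    (\<forall>f :: 'a \<Rightarrow> real. bounded_linear f \<longrightarrow> ((\<lambda>n. f (x n)) \<longlongrightarrow> f l) F)"
proof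
  assume lim: "limitin weak_topology x l F"
  show "\<forall>f :: 'a \<Rightarrow> real. bounded_linear f \<longrightarrow> ((\<lambda>n. f (x n)) \<longlongrightarrow> f l) F"
  proof (intro allI impI topological_tendstoI)
    fix f :: "'a \<Rightarrow> real" and U
    assume "bounded_linear f" "open U" "f l \<in> U"
    moreover from this have "openin weak_topology (f -` U)"
      unfolding weak_topology_def by (intro topology_generated_by_Basis) blast
    ultimately have "\<forall>\<^sub>F n in F. x n \<in> f -` U"
      using lim by (auto simp: limitin_def)
    then show "\<forall>\<^sub>F n in F. f (x n) \<in> U" by simp
  qed
next
  assume lim: "\<forall>f :: 'a \<Rightarrow> real. bounded_linear f \<longrightarrow> ((\<lambda>n. f (x n)) \<longlongrightarrow> f l) F"
  have "\<forall>\<^sub>F n in F. x n \<in> S" if "openin weak_topology S" "l \<in> S" for S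
  proof -
    have "generate_topology_on {f -` U | (f :: 'a \<Rightarrow> real) U. bounded_linear f \<and> open U} S"
      using that(1) by (simp add: weak_topology_def openin_topology_generated_by_iff)
    then show ?thesis using that(2)
    proof induction
      case Empty
      then show ?case by simp
    next
      case (Int A B)
      then show ?case by (auto intro: eventually_conj)
    next
      case (UN K)
      then obtain k where "k \<in> K" "l \<in> k" by blast
      with UN have "\<forall>\<^sub>F n in F. x n \<in> k" by blast
      then show ?case by (rule eventually_mono) (use \<open>k \<in> K\<close> in blast)
    next
      case (Basis A)
      then obtain f :: "'a \<Rightarrow> real" and U where "bounded_linear f" "open U" "A = f -` U"
        by blast
      with lim Basis show ?case
        using topological_tendstoD[of "\<lambda>n. f (x n)" "f l" F U] by simp
    qed
  qed
  then show "limitin weak_topology x l F"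
    by (simp add: limitin_def)
qed

text \<open>The functionals on a subspace \<open>Y\<close> are represented by functions on the whole type that take
  the value \<^const>\<open>undefined\<close> off \<open>Y\<close>, so that each functional has exactly one representative.\<close>

definition dual_on :: "'a::real_normed_vector set \<Rightarrow> ('a \<Rightarrow> real) set" where
  "dual_on Y = {f \<in> extensional Y.
     (\<forall>u\<in>Y. \<forall>v\<in>Y. f (u + v) = f u + f v) \<and>
     (\<forall>c. \<forall>u\<in>Y. f (c *\<^sub>R u) = c * f u) \<and>
     (\<exists>K. \<forall>u\<in>Y. \<bar>f u\<bar> \<le> K * norm u)}"

text \<open>The distance induced by the dual norm. The case distinction is needed because
  \<^locale>\<open>Metric_space\<close> asks for nonnegativity off the carrier too, where the supremum may be
  meaningless.\<close>

definition dual_dist_on ::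
    "'a::real_normed_vector set \<Rightarrow> ('a \<Rightarrow> real) \<Rightarrow> ('a \<Rightarrow> real) \<Rightarrow> real" where
  "dual_dist_on Y f g =
     (if f \<in> dual_on Y \<and> g \<in> dual_on Y then (SUP y \<in> Y \<inter> cball 0 1. \<bar>f y - g y\<bar>) else 0)"

lemma bdd_above_dual_on:
  assumes "f \<in> dual_on Y" "g \<in> dual_on Y"
  shows "bdd_above ((\<lambda>y. \<bar>f y - g y\<bar>) ` (Y \<inter> cball 0 1))"
proof -
  obtain K L where K: "\<And>u. u \<in> Y \<Longrightarrow> \<bar>f u\<bar> \<le> K * norm u"
    and L: "\<And>u. u \<in> Y \<Longrightarrow> \<bar>g u\<bar> \<le> L * norm u"
    using assms unfolding dual_on_def by blast
  show ?thesis
  proof (rule bdd_aboveI2)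
    fix y assume y: "y \<in> Y \<inter> cball 0 1"
    then have "\<bar>f y\<bar> \<le> \<bar>K\<bar> * 1" "\<bar>g y\<bar> \<le> \<bar>L\<bar> * 1"
      using K[of y] L[of y] mult_mono[of K "\<bar>K\<bar>" "norm y" 1] mult_mono[of L "\<bar>L\<bar>" "norm y" 1]
      by (simp_all add: abs_ge_self)
    then show "\<bar>f y - g y\<bar> \<le> \<bar>K\<bar> + \<bar>L\<bar>" by linarith
  qed
qed

lemma Metric_space_dual_on:
  assumes Y: "subspace Y"
  shows "Metric_space (dual_on Y) (dual_dist_on Y)"
proof
  have 0: "0 \<in> Y \<inter> cball 0 1" using Y by (simp add: subspace_0)
  have ge: "\<bar>f y - g y\<bar> \<le> dual_dist_on Y f g"
    if "f \<in> dual_on Y" "g \<in> dual_on Y" "y \<in> Y \<inter> cball 0 1" for f g y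
    using that unfolding dual_dist_on_def
    by (simp del: Int_iff) (rule cSUP_upper[OF _ bdd_above_dual_on], auto)
  fix f g h :: "'a \<Rightarrow> real"
  show "0 \<le> dual_dist_on Y f g"
    using ge[of f g, OF _ _ 0] by (cases "f \<in> dual_on Y \<and> g \<in> dual_on Y")
      (force simp: dual_dist_on_def)+
  show "dual_dist_on Y f g = dual_dist_on Y g f"
    by (auto simp: dual_dist_on_def abs_minus_commute)
  show "dual_dist_on Y f g = 0 \<longleftrightarrow> f = g" if fg: "f \<in> dual_on Y" "g \<in> dual_on Y"
  proof
    assume d: "dual_dist_on Y f g = 0"
    have "f y = g y" if y: "y \<in> Y" for y
    proof -
      let ?c = "inverse (norm y + 1)"
      have c: "0 < ?c" by (simp add: add_nonneg_pos)
      have "?c *\<^sub>R y \<in> Y \<inter> cball 0 1"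
        using y Y norm_ge_zero[of y]
        by (auto simp: subspace_scale divide_simps add_nonneg_eq_0_iff simp del: norm_ge_zero)
      from ge[OF fg this] d have "f (?c *\<^sub>R y) = g (?c *\<^sub>R y)" by simp
      then have "?c * f y = ?c * g y" using fg y by (simp add: dual_on_def)
      with c show ?thesis by simp
    qed
    then show "f = g" using fg by (intro extensionalityI[of f Y g]) (auto simp: dual_on_def)
  next
    assume "f = g"
    moreover have "(SUP y \<in> Y \<inter> cball 0 1. 0::real) = 0" using 0 by (intro cSUP_const) blast
    ultimately show "dual_dist_on Y f g = 0" by (simp add: dual_dist_on_def)
  qed
  show "dual_dist_on Y f h \<le> dual_dist_on Y f g + dual_dist_on Y g h"
    if fgh: "f \<in> dual_on Y" "g \<in> dual_on Y" "h \<in> dual_on Y"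
  proof -
    have "(SUP y \<in> Y \<inter> cball 0 1. \<bar>f y - h y\<bar>) \<le> dual_dist_on Y f g + dual_dist_on Y g h"
    proof (rule cSUP_least)
      fix y assume "y \<in> Y \<inter> cball 0 1"
      from ge[OF fgh(1,2) this] ge[OF fgh(2,3) this]
      show "\<bar>f y - h y\<bar> \<le> dual_dist_on Y f g + dual_dist_on Y g h" by linarith
    qed (use 0 in blast)
    with fgh show ?thesis by (simp add: dual_dist_on_def)
  qed
qed

definition asplund_space :: "'a::real_normed_vector itself \<Rightarrow> bool" where
  "asplund_space _ \<longleftrightarrow> (\<forall>Y :: 'a set. subspace Y \<and> separable_space (top_of_set Y) \<longrightarrow>
     separable_space (Metric_space.mtopology (dual_on Y) (dual_dist_on Y)))"

definition weakly_strongly_extreme :: "'a::real_normed_vector \<Rightarrow> bool" where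
  "weakly_strongly_extreme x \<longleftrightarrow> x \<in> sphere 0 1 \<and>
     (\<forall>z y :: nat \<Rightarrow> 'a. range z \<subseteq> cball 0 1 \<and> range y \<subseteq> cball 0 1 \<and>
        (\<lambda>n. (z n + y n) /\<^sub>R 2) \<longlonglongrightarrow> x \<longrightarrow>
        limitin weak_topology (\<lambda>n. z n - y n) 0 sequentially)"

end

theory Submission
  imports Defs
begin

text \<open>Let a convex combination \<open>p\<close> of the \<open>x\<^sub>n\<close> be close to \<open>x\<close>, and split \<open>p = s + t\<close> according to
  whether \<open>g (x\<^sub>n - x) \<ge> e\<close>, the first part having total weight \<open>w\<close>. The points
  \<open>(2 - w) s + (1 - w) t\<close> and \<open>w s + (1 + w) t\<close> lie in the unit ball and have midpoint \<open>p\<close>, while \<open>g\<close>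
  of their difference is \<open>2 (g s - w g p)\<close>, which is essentially at least \<open>2 w e\<close>. So extremality
  forces \<open>w\<close> to be small, and for finitely many functionals at once some \<open>x\<^sub>n\<close> avoids all the bad
  sets: \<open>x\<close> is in the weak closure of the \<open>x\<^sub>n\<close>. Finally, the dual of the span of \<open>x\<close> and the \<open>x\<^sub>n\<close> is
  separable, so weak convergence of bounded sequences in it is tested by countably many
  functionals.\<close>

section \<open>Separability of countably generated subspaces\<close>

text \<open>Combinations of elements of \<open>B\<close> with rational coefficients are dense in the
  span. Coding them as finite lists of pairs makes their countability immediate.\<close>

lemma separable_space_span_countable:
  fixes B :: "'a::real_normed_vector set"
  assumes "countable B"
  shows "separable_space (top_of_set (span B))"
proof -
  define h :: "(rat \<times> 'a) list \<Rightarrow> 'a"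
    where "h l = sum_list (map (\<lambda>(q, a). of_rat q *\<^sub>R a) l)" for l
  define D where "D = h ` lists (UNIV \<times> B)"
  have cD: "countable D"
    unfolding D_def using assms by (intro countable_image countable_lists countable_SIGMA) auto
  have D_step: "of_rat q *\<^sub>R a + d \<in> D" if a: "a \<in> B" and d: "d \<in> D" for q a d
  proof -
    obtain l where l: "l \<in> lists (UNIV \<times> B)" "d = h l" using d by (auto simp: D_def)
    then have "h ((q, a) # l) \<in> D" unfolding D_def using a by (intro imageI) auto
    then show ?thesis using l by (simp add: h_def)
  qed
  have "h l \<in> span B" if "l \<in> lists (UNIV \<times> B)" for l
    using that by (induction l) (auto simp: h_def span_zero span_add span_scale span_base)
  then have sub: "D \<subseteq> span B" by (auto simp: D_def)
  have cl: "v \<in> closure D" if "v \<in> span B" for v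
    using that
  proof (induction rule: span_induct_alt)
    case base
    have "h [] \<in> D" unfolding D_def by (intro imageI) auto
    then show ?case using closure_subset by (auto simp: h_def)
  next
    case (step c a v)
    show ?case
    proof (rule closure_approachable[THEN iffD2], intro allI impI)
      fix e :: real assume e: "0 < e"
      obtain d where d: "d \<in> D" "dist d v < e / 2"
        using step.IH e by (meson closure_approachable half_gt_zero)
      \<comment> \<open>The \<open>+ 1\<close> keeps the denominator positive when \<open>a\<close>
        is zero and still gives \<open>r * norm a \<le> e / 2\<close>.\<close>
      define r where "r = e / (2 * (norm a + 1))"
      have na: "0 < norm a + 1" by (simp add: add_nonneg_pos)
      have "0 < r" using e na by (simp add: r_def)
      then obtain q where q: "c < of_rat q" "of_rat q < c + r"
        using of_rat_dense[of c "c + r"] by auto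
      have "norm ((of_rat q - c) *\<^sub>R a) \<le> r * norm a"
        using q by (auto intro!: mult_right_mono)
      also have "\<dots> \<le> r * (norm a + 1)" using \<open>0 < r\<close> by (simp add: algebra_simps)
      also have "\<dots> = e / 2" using na by (simp add: r_def field_simps)
      finally have "norm ((of_rat q - c) *\<^sub>R a) \<le> e / 2" .
      moreover have "norm (d - v) < e / 2" using d by (simp add: dist_norm)
      moreover have "norm ((of_rat q *\<^sub>R a + d) - (c *\<^sub>R a + v))
          \<le> norm ((of_rat q - c) *\<^sub>R a) + norm (d - v)"
        by (rule order_trans[OF _ norm_triangle_ineq]) (simp add: algebra_simps)
      ultimately have "dist (of_rat q *\<^sub>R a + d) (c *\<^sub>R a + v) < e" by (simp add: dist_norm)
      then show "\<exists>y\<in>D. dist y (c *\<^sub>R a + v) < e"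
        using \<open>a \<in> B\<close> d(1) D_step by blast
    qed
  qed
  have "(top_of_set (span B)) closure_of D = span B"
    using sub cl by (auto simp: closure_of_subtopology Int_absorb1)
  then show ?thesis
    unfolding separable_space_def using cD sub by auto
qed

section \<open>Extremality and the weight of bad points\<close>

text \<open>Turns the sequential definition into an epsilon-delta statement for one functional: if
  it failed, counterexamples for the radii \<open>1 / (n + 1)\<close> would form two sequences whose
  difference does not tend weakly to 0.\<close>

lemma weakly_strongly_extreme_uniform:
  fixes x :: "'a::real_normed_vector" and g :: "'a \<Rightarrow> real"
  assumes x: "weakly_strongly_extreme x" and g: "bounded_linear g" and e: "0 < e"
  obtains d where "0 < d"
    "\<And>z y. z \<in> cball 0 1 \<Longrightarrow> y \<in> cball 0 1 \<Longrightarrow> norm ((z + y) /\<^sub>R 2 - x) < d \<Longrightarrow> \<bar>g (z - y)\<bar> < e"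
proof (rule ccontr)
  assume nt: "\<not> thesis"
  note wit = that
  have "\<exists>z y. z \<in> cball 0 1 \<and> y \<in> cball 0 1 \<and> norm ((z + y) /\<^sub>R 2 - x) < d \<and> \<not> \<bar>g (z - y)\<bar> < e"
    if "0 < d" for d
    using nt wit that by blast
  then have "\<forall>n::nat. \<exists>z y. z \<in> cball 0 1 \<and> y \<in> cball 0 1 \<and>
      norm ((z + y) /\<^sub>R 2 - x) < inverse (real (Suc n)) \<and> \<not> \<bar>g (z - y)\<bar> < e"
    by simp
  then obtain z y where zy: "\<And>n. z n \<in> cball 0 1" "\<And>n. y n \<in> cball 0 1"
    "\<And>n::nat. norm ((z n + y n) /\<^sub>R 2 - x) < inverse (real (Suc n))"
    and bad: "\<And>n. \<not> \<bar>g (z n - y n)\<bar> < e"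
    by metis
  have "(\<lambda>n. (z n + y n) /\<^sub>R 2 - x) \<longlonglongrightarrow> 0"
    by (rule Lim_null_comparison[OF _ LIMSEQ_inverse_real_of_nat])
      (use zy(3) less_imp_le in \<open>auto intro!: always_eventually\<close>)
  then have "(\<lambda>n. (z n + y n) /\<^sub>R 2) \<longlonglongrightarrow> x" by (simp add: LIM_zero_iff)
  moreover have "range z \<subseteq> cball 0 1" "range y \<subseteq> cball 0 1" using zy by auto
  ultimately have "limitin weak_topology (\<lambda>n. z n - y n) 0 sequentially"
    using x unfolding weakly_strongly_extreme_def by blast
  then have "(\<lambda>n. g (z n - y n)) \<longlonglongrightarrow> g 0"
    using g by (simp add: limitin_weak_topology)
  then have "(\<lambda>n. g (z n - y n)) \<longlonglongrightarrow> 0" using g by (simp add: linear_simps)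
  then have "\<forall>\<^sub>F n in sequentially. \<bar>g (z n - y n)\<bar> < e"
    using tendstoD[OF _ e] by fastforce
  with bad show False by simp
qed

text \<open>The radius \<open>d\<close> depends on \<open>g\<close>, \<open>e\<close> and
  \<open>h\<close> but not on the convex combination. This allows finitely many functionals to be
  handled later with a single combination.\<close>

lemma weakly_strongly_extreme_weight_less:
  fixes x :: "'a::real_normed_vector" and g :: "'a \<Rightarrow> real"
  assumes x: "weakly_strongly_extreme x" and g: "bounded_linear g" and e: "0 < e" and h: "0 < h"
  shows "\<exists>d>0. \<forall>T u. finite T \<and> T \<subseteq> cball 0 1 \<and> (\<forall>a\<in>T. 0 \<le> u a) \<and> sum u T = 1 \<and>
    norm ((\<Sum>a\<in>T. u a *\<^sub>R a) - x) < d \<longrightarrow> sum u {a \<in> T. e \<le> g (a - x)} < h"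
proof -
  interpret g: bounded_linear g by fact
  obtain d1 where d1: "0 < d1"
    "\<And>z y. z \<in> cball 0 1 \<Longrightarrow> y \<in> cball 0 1 \<Longrightarrow> norm ((z + y) /\<^sub>R 2 - x) < d1 \<Longrightarrow> \<bar>g (z - y)\<bar> < h * e"
    using weakly_strongly_extreme_uniform[OF x g mult_pos_pos[OF h e]] by blast
  obtain K where K: "0 < K" "\<And>v. norm (g v) \<le> norm v * K" using g.pos_bounded by blast
  \<comment> \<open>The second bound ensures that \<open>g\<close> changes by at most
    \<open>e / 2\<close> between \<open>x\<close> and the combination.\<close>
  define d where "d = min d1 (e / (2 * K))"
  show ?thesis
  proof (intro exI[of _ d] conjI allI impI)
    show "0 < d" using d1 K e by (simp add: d_def)
  next
    fix T and u :: "'a \<Rightarrow> real"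
    assume "finite T \<and> T \<subseteq> cball 0 1 \<and> (\<forall>a\<in>T. 0 \<le> u a) \<and> sum u T = 1 \<and>
      norm ((\<Sum>a\<in>T. u a *\<^sub>R a) - x) < d"
    then have T: "finite T" "T \<subseteq> cball 0 1" and u: "\<forall>a\<in>T. 0 \<le> u a" "sum u T = 1"
      and near: "norm ((\<Sum>a\<in>T. u a *\<^sub>R a) - x) < d"
      by blast+
    define S where "S = {a \<in> T. e \<le> g (a - x)}"
    define w where "w = sum u S"
    define s where "s = (\<Sum>a\<in>S. u a *\<^sub>R a)"
    define t where "t = (\<Sum>a\<in>T - S. u a *\<^sub>R a)"
    have ST: "S \<subseteq> T" "finite S" using T by (auto simp: S_def)
    have p: "(\<Sum>a\<in>T. u a *\<^sub>R a) = s + t"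
      unfolding s_def t_def using sum.subset_diff[OF ST(1) T(1)] by (simp add: add.commute)
    have w': "sum u (T - S) = 1 - w"
      unfolding w_def using sum.subset_diff[OF ST(1) T(1), of u] u(2) by simp
    have w0: "0 \<le> w" unfolding w_def using u ST by (intro sum_nonneg) auto
    have "0 \<le> sum u (T - S)" using u by (intro sum_nonneg) auto
    then have w1: "w \<le> 1" using w' by simp
    have part: "norm (\<Sum>a\<in>R. u a *\<^sub>R a) \<le> sum u R" if "R \<subseteq> T" for R
    proof (rule sum_norm_le)
      fix a assume "a \<in> R"
      then have "0 \<le> u a" "norm a \<le> 1" using that T u by auto
      then show "norm (u a *\<^sub>R a) \<le> u a" by (simp add: mult_left_le)
    qed
    have ns: "norm s \<le> w" and nt: "norm t \<le> 1 - w"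
      using part[of S] part[of "T - S"] ST w' by (auto simp: s_def t_def w_def)
    \<comment> \<open>For both \<open>s\<close> and \<open>t\<close> the two coefficients average to
      1, so the midpoint is \<open>s + t\<close>. Since \<open>norm s \<le> w\<close> and
      \<open>norm t \<le> 1 - w\<close>, the norm bounds of \<open>z\<close> and \<open>y\<close>
      add up to exactly 1.\<close>
    define z where "z = (2 - w) *\<^sub>R s + (1 - w) *\<^sub>R t"
    define y where "y = w *\<^sub>R s + (1 + w) *\<^sub>R t"
    have "norm z \<le> (2 - w) * norm s + (1 - w) * norm t"
      unfolding z_def using norm_triangle_ineq[of "(2 - w) *\<^sub>R s" "(1 - w) *\<^sub>R t"] w1 by simp
    also have "\<dots> \<le> (2 - w) * w + (1 - w) * (1 - w)"
      using ns nt w1 by (intro add_mono mult_left_mono) auto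
    also have "\<dots> = 1" by (simp add: algebra_simps)
    finally have z: "z \<in> cball 0 1" by simp
    have "norm y \<le> w * norm s + (1 + w) * norm t"
      unfolding y_def using norm_triangle_ineq[of "w *\<^sub>R s" "(1 + w) *\<^sub>R t"] w0 by simp
    also have "\<dots> \<le> w * w + (1 + w) * (1 - w)"
      using ns nt w0 by (intro add_mono mult_left_mono) auto
    also have "\<dots> = 1" by (simp add: algebra_simps)
    finally have y: "y \<in> cball 0 1" by simp
    have "z + y = 2 *\<^sub>R (s + t)"
      by (simp add: z_def y_def algebra_simps flip: scaleR_2)
    then have "(z + y) /\<^sub>R 2 = s + t" by simp
    then have "\<bar>g (z - y)\<bar> < h * e" using d1(2)[OF z y] near by (simp add: p d_def)
    moreover have "g (z - y) = 2 * (g s - w * g (s + t))"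
      by (simp add: z_def y_def g.add g.diff g.scaleR algebra_simps)
    moreover have "w * (g x + e) \<le> g s"
    proof -
      have "w * (g x + e) = (\<Sum>a\<in>S. u a * (g x + e))" by (simp add: w_def sum_distrib_right)
      also have "\<dots> \<le> (\<Sum>a\<in>S. u a * g a)"
        using u by (intro sum_mono mult_left_mono) (auto simp: S_def g.diff)
      also have "\<dots> = g s" by (simp add: s_def g.sum g.scaleR)
      finally show ?thesis .
    qed
    moreover have "w * g (s + t) \<le> w * (g x + e / 2)"
    proof -
      have "\<bar>g (s + t - x)\<bar> \<le> norm (s + t - x) * K" using K(2)[of "s + t - x"] by simp
      also have "\<dots> \<le> e / (2 * K) * K"
        using near K(1) by (intro mult_right_mono) (auto simp: p d_def)
      also have "\<dots> = e / 2" using K(1) by simp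
      finally have "\<bar>g (s + t) - g x\<bar> \<le> e / 2" by (simp only: g.diff)
      then have "g (s + t) \<le> g x + e / 2" by linarith
      then show ?thesis using w0 by (rule mult_left_mono)
    qed
    \<comment> \<open>Subtracting the two estimates leaves
      \<open>g s - w * g (s + t) \<ge> w * e / 2\<close>, and doubling gives
      \<open>w * e \<le> g (z - y) < h * e\<close>.\<close>
    ultimately have "w * e < h * e" by (simp add: algebra_simps abs_less_iff)
    then show "sum u {a \<in> T. e \<le> g (a - x)} < h" using e by (simp add: w_def S_def)
  qed
qed

text \<open>A union bound: for a combination close enough to \<open>x\<close>, the bad sets of all
  the functionals together weigh less than 1, so they cannot cover its support.\<close>

lemma weakly_strongly_extreme_in_weak_closure:
  fixes x :: "'a::real_normed_vector" and G :: "('a \<Rightarrow> real) set"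
  assumes x: "weakly_strongly_extreme x" and A: "A \<subseteq> cball 0 1"
    and hull: "x \<in> closure (convex hull A)"
    and G: "finite G" "\<And>g. g \<in> G \<Longrightarrow> bounded_linear g" and e: "0 < e"
  shows "\<exists>a\<in>A. \<forall>g\<in>G. \<bar>g (a - x)\<bar> < e"
proof -
  \<comment> \<open>Including the negatives turns one-sided bounds into bounds on absolute
    values.\<close>
  define H where "H = G \<union> (\<lambda>g v. - g v) ` G"
  have H: "finite H" "\<And>g. g \<in> H \<Longrightarrow> bounded_linear g"
    using G by (auto simp: H_def intro: bounded_linear_minus)
  define h where "h = 1 / (real (card H) + 1)"
  have h: "0 < h" by (simp add: h_def)
  have "\<forall>g\<in>H. \<exists>d>0. \<forall>T u. finite T \<and> T \<subseteq> cball 0 1 \<and> (\<forall>a\<in>T. 0 \<le> u a) \<and> sum u T = 1 \<and>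
      norm ((\<Sum>a\<in>T. u a *\<^sub>R a) - x) < d \<longrightarrow> sum u {a \<in> T. e \<le> g (a - x)} < h"
    by (intro ballI weakly_strongly_extreme_weight_less[OF x H(2) e h])
  from bchoice[OF this] obtain d where d: "\<forall>g\<in>H. 0 < d g \<and>
      (\<forall>T u. finite T \<and> T \<subseteq> cball 0 1 \<and> (\<forall>a\<in>T. 0 \<le> u a) \<and> sum u T = 1 \<and>
        norm ((\<Sum>a\<in>T. u a *\<^sub>R a) - x) < d g \<longrightarrow> sum u {a \<in> T. e \<le> g (a - x)} < h)"
    by (rule exE)
  have d0: "0 < d g" if "g \<in> H" for g using d that by simp
  \<comment> \<open>Inserting 1 keeps the minimum meaningful when \<open>H\<close> is empty.\<close>
  define m where "m = Min (insert 1 (d ` H))"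
  have "0 < m" and m: "\<And>g. g \<in> H \<Longrightarrow> m \<le> d g"
    unfolding m_def using H(1) d0 by auto
  then obtain p where p: "p \<in> convex hull A" "norm (p - x) < m"
    using hull by (auto simp: closure_approachable dist_norm)
  then obtain T u where T: "finite T" "T \<subseteq> A" "\<forall>a\<in>T. 0 \<le> u a" "sum u T = 1"
    and pu: "(\<Sum>a\<in>T. u a *\<^sub>R a) = p"
    unfolding convex_hull_explicit by blast
  have bad: "sum u {a \<in> T. e \<le> g (a - x)} \<le> h" if "g \<in> H" for g
  proof -
    have "T \<subseteq> cball 0 1" using T(2) A by blast
    moreover have "norm ((\<Sum>a\<in>T. u a *\<^sub>R a) - x) < d g" using p(2) m[OF that] pu by simp
    ultimately have "sum u {a \<in> T. e \<le> g (a - x)} < h"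
      using bspec[OF d that, THEN conjunct2, rule_format, of T u] T(1,3,4) by simp
    then show ?thesis by simp
  qed
  have "\<exists>a\<in>T. \<forall>g\<in>H. g (a - x) < e"
  proof (rule ccontr)
    assume "\<not> ?thesis"
    then have ex: "\<exists>g\<in>H. e \<le> g (a - x)" if "a \<in> T" for a using that by (auto simp: not_less)
    have "1 = sum u T" using T(4) by simp
    \<comment> \<open>Every \<open>a\<close> is bad for some \<open>g\<close>, so its weight is
      counted at least once. Swapping the sums then yields the total weight of the bad sets.\<close>
    also have "\<dots> \<le> (\<Sum>a\<in>T. \<Sum>g\<in>H. if e \<le> g (a - x) then u a else 0)"
    proof (rule sum_mono)
      fix a assume a: "a \<in> T"
      then obtain g where g: "g \<in> H" "e \<le> g (a - x)" using ex by blast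
      show "u a \<le> (\<Sum>g\<in>H. if e \<le> g (a - x) then u a else 0)"
        using member_le_sum[OF g(1), of "\<lambda>g. if e \<le> g (a - x) then u a else 0"] g(2) T(3) a H(1)
        by auto
    qed
    also have "\<dots> = (\<Sum>g\<in>H. sum u {a \<in> T. e \<le> g (a - x)})"
      using T(1) by (subst sum.swap) (simp add: sum.inter_filter)
    also have "\<dots> \<le> (\<Sum>g\<in>H. h)" using bad by (intro sum_mono) auto
    also have "\<dots> < 1" by (simp add: h_def)
    finally show False by simp
  qed
  then obtain a where a: "a \<in> T" "\<And>g. g \<in> H \<Longrightarrow> g (a - x) < e" by blast
  have "\<bar>g (a - x)\<bar> < e" if "g \<in> G" for g
    using a(2)[of g] a(2)[of "\<lambda>v. - g v"] that by (auto simp: H_def abs_less_iff)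
  then show ?thesis using a(1) T(2) by blast
qed

section \<open>Countably many test functionals from a separable dual\<close>

lemma restrict_bounded_linear_in_dual_on:
  assumes "subspace Y" "bounded_linear f"
  shows "restrict f Y \<in> dual_on Y"
proof -
  interpret f: bounded_linear f by fact
  obtain K where "\<And>v. norm (f v) \<le> norm v * K" using f.bounded by blast
  then have "\<exists>K. \<forall>u\<in>Y. \<bar>f u\<bar> \<le> K * norm u" by (auto simp: mult.commute)
  then show ?thesis
    using assms(1) by (auto simp: dual_on_def subspace_add subspace_scale f.add f.scaleR)
qed

lemma abs_diff_le_dual_dist_on:
  assumes "f \<in> dual_on Y" "g \<in> dual_on Y" "y \<in> Y" "norm y \<le> 1"
  shows "\<bar>f y - g y\<bar> \<le> dual_dist_on Y f g"
proof -
  have "y \<in> Y \<inter> cball 0 1" using assms by simp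
  then have "\<bar>f y - g y\<bar> \<le> (SUP y \<in> Y \<inter> cball 0 1. \<bar>f y - g y\<bar>)"
    by (rule cSUP_upper[OF _ bdd_above_dual_on[OF assms(1,2)]])
  then show ?thesis using assms(1,2) by (simp only: dual_dist_on_def simp_thms if_True)
qed

text \<open>The approximants are functionals on the whole space; choosing them among the restrictions to
  \<open>Y\<close> makes the Hahn--Banach theorem unnecessary.\<close>

lemma separable_dual_countable_functionals:
  fixes Y :: "'a::real_normed_vector set"
  assumes Y: "subspace Y"
    and sep: "separable_space (Metric_space.mtopology (dual_on Y) (dual_dist_on Y))"
  obtains F :: "nat \<Rightarrow> 'a \<Rightarrow> real"
  where "\<And>i. bounded_linear (F i)"
    "\<And>f e. bounded_linear f \<Longrightarrow> 0 < e \<Longrightarrow>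
       \<exists>i. \<forall>y\<in>Y. norm y \<le> 1 \<longrightarrow> \<bar>f y - F i y\<bar> < e"
proof -
  interpret M: Metric_space "dual_on Y" "dual_dist_on Y" by (rule Metric_space_dual_on[OF Y])
  obtain C where C: "countable C" "C \<subseteq> dual_on Y" "M.mtopology closure_of C = dual_on Y"
    using sep by (auto simp: separable_space_def)
  define P where "P c n f \<longleftrightarrow> bounded_linear f \<and> dual_dist_on Y c (restrict f Y) < inverse (real (Suc n))"
    for c n and f :: "'a \<Rightarrow> real"
  \<comment> \<open>A point \<open>c\<close> of the dense set need not be given as a restriction, so
    it is replaced by some global functional within \<open>1 / (n + 1)\<close> of it on
    \<open>Y\<close>. The default 0 keeps every \<open>\<Phi> c n\<close> bounded linear.\<close>
  define \<Phi> where "\<Phi> c n = (if \<exists>f. P c n f then SOME f. P c n f else (\<lambda>_. 0))" for c n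
  have bl: "bounded_linear (\<Phi> c n)" for c n
    using someI_ex[of "P c n"] by (auto simp: \<Phi>_def P_def bounded_linear_zero)
  have near: "\<exists>c\<in>C. \<exists>n. \<forall>y\<in>Y. norm y \<le> 1 \<longrightarrow> \<bar>f y - \<Phi> c n y\<bar> < e"
    if f: "bounded_linear f" and e: "0 < e" for f e
  proof -
    have fY: "restrict f Y \<in> dual_on Y" by (rule restrict_bounded_linear_in_dual_on[OF Y f])
    obtain n where n: "inverse (real (Suc n)) < e / 2" using reals_Archimedean[of "e/2"] e by auto
    have "restrict f Y \<in> M.mtopology closure_of C" using fY C(3) by simp
    then have "\<exists>c\<in>C. c \<in> M.mball (restrict f Y) (inverse (real (Suc n)))"
      unfolding M.metric_closure_of by simp
    then obtain c where c: "c \<in> C" "dual_dist_on Y c (restrict f Y) < inverse (real (Suc n))"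
      by (auto simp: M.in_mball M.commute)
    \<comment> \<open>The functional \<open>f\<close> to be approximated is itself a witness, so the
      choice defining \<open>\<Phi> c n\<close> succeeds.\<close>
    have "\<exists>f. P c n f" using c f by (auto simp: P_def)
    then have "P c n (\<Phi> c n)" by (simp add: \<Phi>_def someI_ex)
    then have d: "dual_dist_on Y c (restrict (\<Phi> c n) Y) < inverse (real (Suc n))"
      by (simp add: P_def)
    have cY: "c \<in> dual_on Y" using C c by blast
    \<comment> \<open>Both \<open>f\<close> and \<open>\<Phi> c n\<close> are within
      \<open>e / 2\<close> of \<open>c\<close> on the unit ball of \<open>Y\<close>.\<close>
    have "\<bar>f y - \<Phi> c n y\<bar> < e" if y: "y \<in> Y" "norm y \<le> 1" for y
      using abs_diff_le_dual_dist_on[OF cY fY y] c(2) d n y(1)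
        abs_diff_le_dual_dist_on[OF cY restrict_bounded_linear_in_dual_on[OF Y bl, of c n] y]
      by simp
    then show ?thesis using c(1) by blast
  qed
  define \<F> where "\<F> = (\<lambda>(c, n). \<Phi> c n) ` (C \<times> UNIV)"
  have "countable \<F>" unfolding \<F>_def using C(1) by (intro countable_image countable_SIGMA) auto
  moreover have "\<F> \<noteq> {}" using near[OF bounded_linear_zero, of 1] by (auto simp: \<F>_def)
  ultimately have r: "range (from_nat_into \<F>) = \<F>" by (simp add: range_from_nat_into)
  show thesis
  proof
    show "bounded_linear (from_nat_into \<F> i)" for i
    proof -
      have "from_nat_into \<F> i \<in> \<F>" using r by blast
      then show ?thesis using bl by (auto simp: \<F>_def)
    qed
    fix f :: "'a \<Rightarrow> real" and e :: real
    assume "bounded_linear f" "0 < e"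
    from near[OF this] obtain c n where cn: "c \<in> C"
      "\<forall>y\<in>Y. norm y \<le> 1 \<longrightarrow> \<bar>f y - \<Phi> c n y\<bar> < e" by blast
    have "\<Phi> c n \<in> range (from_nat_into \<F>)" unfolding r unfolding \<F>_def using cn(1) by force
    then obtain i where "from_nat_into \<F> i = \<Phi> c n" by (metis rangeE)
    then show "\<exists>i. \<forall>y\<in>Y. norm y \<le> 1 \<longrightarrow> \<bar>f y - from_nat_into \<F> i y\<bar> < e" using cn(2) by metis
  qed
qed

theorem theorem2p5:
  fixes x :: "'a::banach" and xs :: "nat \<Rightarrow> 'a"
  assumes "asplund_space TYPE('a)"
    and "x \<in> sphere 0 1"
    and "weakly_strongly_extreme x"
    and "range xs \<subseteq> cball 0 1"
    and "x \<in> closure (convex hull (range xs))"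
  shows "\<exists>n :: nat \<Rightarrow> nat. limitin weak_topology (\<lambda>k. xs (n k)) x sequentially"
proof -
  \<comment> \<open>The point \<open>x\<close> is adjoined because it is only a limit of convex
    combinations and may lie outside the span of the \<open>xs n\<close>.\<close>
  define Y where "Y = span (insert x (range xs))"
  have Y: "subspace Y" and xY: "x \<in> Y" and xsY: "\<And>n. xs n \<in> Y"
    by (auto simp: Y_def span_base)
  have nx: "norm x \<le> 1" and nxs: "\<And>n. norm (xs n) \<le> 1" using assms(2,4) by (auto simp: image_subset_iff)
  have "separable_space (top_of_set Y)"
    unfolding Y_def by (intro separable_space_span_countable) auto
  with assms(1) Y have "separable_space (Metric_space.mtopology (dual_on Y) (dual_dist_on Y))"
    by (auto simp: asplund_space_def)
  then obtain F :: "nat \<Rightarrow> 'a \<Rightarrow> real" where F: "\<And>i. bounded_linear (F i)"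
    "\<And>f e. bounded_linear f \<Longrightarrow> 0 < e \<Longrightarrow> \<exists>i. \<forall>y\<in>Y. norm y \<le> 1 \<longrightarrow> \<bar>f y - F i y\<bar> < e"
    using separable_dual_countable_functionals[OF Y] by blast
  \<comment> \<open>A diagonal choice: stage \<open>k\<close> controls the functionals
    \<open>F 0\<close> to \<open>F k\<close> with tolerance \<open>1 / (k + 1)\<close>, so each
    fixed \<open>F i\<close> is controlled from stage \<open>i\<close> on.\<close>
  have "\<exists>a\<in>range xs. \<forall>g\<in>F ` {..k}. \<bar>g (a - x)\<bar> < inverse (real (Suc k))" for k
    using F(1) by (intro weakly_strongly_extreme_in_weak_closure[OF assms(3,4,5)]) auto
  then have "\<forall>k. \<exists>n. \<forall>i\<le>k. \<bar>F i (xs n - x)\<bar> < inverse (real (Suc k))" by fastforce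
  then obtain n where n: "\<And>k i. i \<le> k \<Longrightarrow> \<bar>F i (xs (n k) - x)\<bar> < inverse (real (Suc k))" by metis
  have "(\<lambda>k. f (xs (n k))) \<longlonglongrightarrow> f x" if f: "bounded_linear f" for f :: "'a \<Rightarrow> real"
  proof (rule LIMSEQ_I)
    fix e :: real assume e: "0 < e"
    obtain i where i: "\<And>y. y \<in> Y \<Longrightarrow> norm y \<le> 1 \<Longrightarrow> \<bar>f y - F i y\<bar> < e / 3"
      using F(2)[OF f, of "e / 3"] e by auto
    obtain m where m: "inverse (real (Suc m)) < e / 3" using reals_Archimedean[of "e / 3"] e by auto
    have "norm (f (xs (n k)) - f x) < e" if k: "max i m \<le> k" for k
    proof -
      have "inverse (real (Suc k)) \<le> inverse (real (Suc m))" using k by simp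
      moreover have "\<bar>F i (xs (n k) - x)\<bar> < inverse (real (Suc k))" using n k by simp
      ultimately have "\<bar>F i (xs (n k)) - F i x\<bar> < e / 3"
        using m unfolding linear_simps(2)[OF F(1)] by linarith
      \<comment> \<open>Three errors below \<open>e / 3\<close>: replacing \<open>f\<close> by
        \<open>F i\<close> at \<open>xs (n k)\<close>, moving from there to \<open>x\<close>, and
        replacing \<open>F i\<close> by \<open>f\<close> at \<open>x\<close>.\<close>
      then show ?thesis using i[OF xY nx] i[OF xsY nxs, of "n k"]
        unfolding real_norm_def by linarith
    qed
    then show "\<exists>k0. \<forall>k\<ge>k0. norm (f (xs (n k)) - f x) < e" by blast
  qed
  then show ?thesis by (auto simp: limitin_weak_topology)
qed

end
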